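(* Consider $L$ agents $$\dot\xi^\ell=g^\ell(\xi^\ell,\upsilon^\ell,\omega^\ell),\quad \zeta_1^\ell=\xi^\ell,\quad \zeta_2^\ell=C\xi^\ell,\qquad g^\ell(x,u,w)=\alpha_\ell(x)+\beta_\ell(x)u+Bw,\quad \ell=1,\dots,L,$$ interconnected by $[\omega^1;\dots;\omega^L]=(\tilde M\otimes I_p)[\zeta_2^1;\dots;\zeta_2^L]$, where $\tilde M\in\mathbb{R}^{L\times L}$ satisfies $$\tilde M+\tilde M^T\le0 .$$ Suppose that for each $\ell=1,\dots,L$ there exist a locally Lipschitz $\tilde v^\ell:\mathbb{R}^n\times\mathbb{R}^n\times\mathbb{R}^m\to\mathbb{R}^m$, $\tilde\rho^\ell\in\mathcal{K}\cup\{0\}$, constants $\lambda_\ell,\vartheta_\ell$ and $Q_\ell=Q_\ell^T>0$ in $\mathbb{R}^{n\times n}$ such that, for all $x,\hat x\in\mathbb{R}^n$, $\hat u\in\mathbb{R}^m$, $$Q_\ell\frac{\partial\alpha_\ell(x)}{\partial x}+\Big(\frac{\partial\alpha_\ell(x)}{\partial x}\Big)^TQ_\ell\le2\lambda_\ell I_n,\qquad (x-\hat x)^TQ_\ell\big(\beta_\ell(x)\tilde v^\ell(x,\hat x,\hat u)-\beta(\hat x)\hat u\big)\le\vartheta_\ell\|x-\hat x\|^2+\tilde\rho^\ell(\|\hat u\|),$$ $$\lambda_\ell+\vartheta_\ell<0,\qquad Q_\ell B=C^T .$$ Let the agents be partitioned into $N\le L$ groups with partition matrix $P\in\mathbb{R}^{L\times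 N}$, let $\bar M\in\mathbb{R}^{N\times N}$, and let $\Sigma$, $\hat\Sigma$ be the concrete and aggregate interconnected systems described in the context. Let $$V(x,\hat x):=\sum_{i=1}^N\mu_iV_i(x_i,\hat x_i),\qquad \mu_i=1,\quad V_i(x_i,\hat x_i)=\sum_{\ell\in\text{group }i}\tilde V^\ell(x^\ell,\hat x_i),\qquad \tilde V^\ell(x,\hat x)=\tfrac12(x-\hat x)^TQ_\ell(x-\hat x).$$ 1. If the partition is equitable, i.e. $\tilde MP=P\bar M$, then $V$ is a practical simulation function from $\hat\Sigma$ to $\Sigma$. 2. If the equitability condition is relaxed, so that $\bar Y:=\tilde MP-P\bar M$ is nonzero, then $V$ is a practical simulation function from $\hat\Sigma$ to $\Sigma$ if there exists a matrix $Z=Z^T\ge0$ satisfying $$\begin{bmatrix}Y&M\\ 0&I_{Lp}\end{bmatrix}^TX\begin{bmatrix}Y&M\\ 0&I_{Lp}\end{bmatrix}-\begin{bmatrix}Z&0\\ 0&0\end{bmatrix}\le0,\qquad Y=\bar Y\otimes I_p,\quad M=\tilde M\otimes I_p,\quad X=\frac12\begin{bmatrix}0&I_{Lp}\\ I_{Lp}&0\end{bmatrix}.$$ 3. Furthermore, $\mathcal{N}(\tilde M+\tilde M^T)\subseteq\mathcal{N}(\bar Y^T)$ is a necessary and sufficient condition for such a $Z$ to exist.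
   Context: **Notation.** $\mathcal{K}$: continuous strictly increasing functions $\mathbb{R}_{\ge0}\to\mathbb{R}_{\ge0}$ vanishing at $0$; $\mathcal{K}_\infty$: those in $\mathcal{K}$ tending to infinity at infinity. $\|\cdot\|$ is the Euclidean norm, $\otimes$ the Kronecker product, $\mathbf{1}_k$ the all-ones vector in $\mathbb{R}^k$, $\mathcal{N}(\cdot)$ the null space, $[x_1;\dots;x_N]$ concatenation. Matrix inequalities are in the semidefinite sense. **Agents.** $\xi^\ell\in\mathbb{R}^n$, $\upsilon^\ell\in\mathbb{R}^m$, $\omega^\ell\in\mathbb{R}^p$, $B\in\mathbb{R}^{n\times p}$, $C\in\mathbb{R}^{p\times n}$. The maps $\alpha_\ell:\mathbb{R}^n\to\mathbb{R}^n$ (continuously differentiable) and $\beta_\ell:\mathbb{R}^n\to\mathbb{R}^{n\times m}$ may vary with $\ell$; $\alpha:\mathbb{R}^n\to\mathbb{R}^n$ and $\beta:\mathbb{R}^n\to\mathbb{R}^{n\times m}$ are nominal maps used in the abstraction, with $g(\hat x,\hat u,\hat w)=\alpha(\hat x)+\beta(\hat x)\hat u+B\hat w$. The right-hand sides $g^\ell,g$ are locally Lipschitz. **Partition.** Each agent belongs to exactly one group and each group is nonempty; $P_{\ell,i}=1$ if agent $\ell$ is in group $i$ and $0$ otherwise; $L_i\ge1$ is the number of agents in group $i$. Agents are indexed so that the first $L_1$ constitute group 1, the next $L_2$ group 2, and so on, so $P=\mathrm{diag}(\mathbf{1}_{L_1},\dots,\mathbf{1}_{L_N})$. The partition is equitable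 if $\tilde MP=P\bar M$ for some $\bar M\in\mathbb{R}^{N\times N}$ (and then this $\bar M$ is used in the abstraction). **Concrete system $\Sigma$.** State $x=[x_1;\dots;x_N]$ where $x_i\in\mathbb{R}^{L_in}$ concatenates the states $x^\ell$ of the agents in group $i$ (so $x=[x^1;\dots;x^L]$), input the concatenation of all $u^\ell$, dynamics $\dot x^\ell=g^\ell(x^\ell,u^\ell,w^\ell)$ with $[w^1;\dots;w^L]=(\tilde M\otimes I_p)[Cx^1;\dots;Cx^L]$, output $h(x)=[x^1;\dots;x^L]$. **Aggregate system $\hat\Sigma$.** State $\hat x=[\hat x_1;\dots;\hat x_N]$, $\hat x_i\in\mathbb{R}^n$, input $\hat u=[\hat u_1;\dots;\hat u_N]$, $\hat u_i\in\mathbb{R}^m$, dynamics $\dot{\hat x}_i=g(\hat x_i,\hat u_i,\hat w_i)$ with $[\hat w_1;\dots;\hat w_N]=(\bar M\otimes I_p)[C\hat x_1;\dots;C\hat x_N]$, output $\hat h(\hat x)=[\mathbf{1}_{L_1}\otimes\hat x_1;\dots;\mathbf{1}_{L_N}\otimes\hat x_N]$. **Practical simulation function.** For control systems $\Sigma$: $\dot x=f(x,u)$ with output $h(x)$, and $\hat\Sigma$: $\dot{\hat x}=\hat f(\hat x,\hat u)$ with output $\hat h(\hat x)$ in the same output space, a continuously differentiable nonnegative $V(x,\hat x)$ is a practical simulation function from $\hat\Sigma$ to $\Sigma$ if there exist a locally Lipschitz interface $v(x,\hat x,\hat u)$, functions $\nu,\eta\in\mathcal{K}_\infty$, $\rho\in\mathcal{K}\cup\{0\}$,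 and a function $\Delta(\hat x)\ge0$ such that for all $x,\hat x,\hat u$: $\nu(\|h(x)-\hat h(\hat x)\|)\le V(x,\hat x)$ and $$\frac{\partial V(x,\hat x)}{\partial x}f(x,v(x,\hat x,\hat u))+\frac{\partial V(x,\hat x)}{\partial\hat x}\hat f(\hat x,\hat u)\le-\eta(V(x,\hat x))+\rho(\|\hat u\|)+\Delta(\hat x).$$ *)

theory Defs
  imports "HOL-Analysis.Analysis"
begin

subsection \<open>Function classes\<close>

(* Comparison functions live on [0,\<infinity>); the values at negative arguments are irrelevant. *)
definition class_K :: "(real \<Rightarrow> real) \<Rightarrow> bool" where
  "class_K \<gamma> \<longleftrightarrow> continuous_on {0..} \<gamma> \<and> strict_mono_on {0..} \<gamma> \<and> \<gamma> 0 = 0"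

definition class_K_inf :: "(real \<Rightarrow> real) \<Rightarrow> bool" where
  "class_K_inf \<gamma> \<longleftrightarrow> class_K \<gamma> \<and> filterlim \<gamma> at_top at_top"

definition class_K_or_zero :: "(real \<Rightarrow> real) \<Rightarrow> bool" where
  "class_K_or_zero \<gamma> \<longleftrightarrow> class_K \<gamma> \<or> (\<forall>s\<ge>0. \<gamma> s = 0)"

definition locally_lipschitz :: "('a::metric_space \<Rightarrow> 'b::metric_space) \<Rightarrow> bool" where
  "locally_lipschitz f \<longleftrightarrow> (\<forall>x. \<exists>u>0. \<exists>K. K-lipschitz_on (cball x u) f)"

definition continuously_differentiable ::
    "('a::real_normed_vector \<Rightarrow> 'b::real_normed_vector) \<Rightarrow> bool" where
  "continuously_differentiable f \<longleftrightarrow>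
     (\<exists>f' :: 'a \<Rightarrow> 'a \<Rightarrow>\<^sub>L 'b.
        (\<forall>x. (f has_derivative blinfun_apply (f' x)) (at x)) \<and> continuous_on UNIV f')"

subsection \<open>Matrices\<close>

(* The order \<le> that the library puts on vectors and matrices is componentwise, so the
   semidefinite order gets its own name. *)
definition pos_semidef :: "real^'a^'a \<Rightarrow> bool" where
  "pos_semidef A \<longleftrightarrow> transpose A = A \<and> (\<forall>x. 0 \<le> x \<bullet> (A *v x))"

definition pos_def :: "real^'a^'a \<Rightarrow> bool" where
  "pos_def A \<longleftrightarrow> transpose A = A \<and> (\<forall>x. x \<noteq> 0 \<longrightarrow> 0 < x \<bullet> (A *v x))"

definition semidef_le :: "real^'a^'a \<Rightarrow> real^'a^'a \<Rightarrow> bool"  (infix \<open>\<preceq>\<close> 50) where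
  "A \<preceq> B \<longleftrightarrow> pos_semidef (B - A)"

definition null_space :: "real^'a^'b \<Rightarrow> (real^'a) set" where
  "null_space A = {x. A *v x = 0}"

definition kron :: "real^'a^'b \<Rightarrow> real^'c^'d \<Rightarrow> real^('a \<times> 'c)^('b \<times> 'd)"  (infixl \<open>\<otimes>\<^sub>K\<close> 70) where
  "A \<otimes>\<^sub>K B = (\<chi> r c. A $ fst r $ fst c * B $ snd r $ snd c)"

(* block_mat A B C D is the matrix with block rows [A B] and [C D]. *)
definition block_mat ::
    "real^'a^'c \<Rightarrow> real^'b^'c \<Rightarrow> real^'a^'d \<Rightarrow> real^'b^'d \<Rightarrow> real^('a + 'b)^('c + 'd)" where
  "block_mat A B C D = (\<chi> r c. case r of
       Inl i \<Rightarrow> (case c of Inl j \<Rightarrow> A $ i $ j | Inr j \<Rightarrow> B $ i $ j)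
     | Inr i \<Rightarrow> (case c of Inl j \<Rightarrow> C $ i $ j | Inr j \<Rightarrow> D $ i $ j))"

(* A concatenation [x_1; ...; x_k] of vectors in R^q is kept as an element of real^'q^'k, whose
   norm is the Euclidean norm of the concatenated vector. The maps stack and unstack pass to and
   from the index set on which a Kronecker product acts. *)
definition stack :: "real^'q^'k \<Rightarrow> real^('k \<times> 'q)" where
  "stack x = (\<chi> r. x $ fst r $ snd r)"

definition unstack :: "real^('k \<times> 'q) \<Rightarrow> real^'q^'k" where
  "unstack y = (\<chi> i j. y $ (i, j))"

subsection \<open>Practical simulation functions\<close>

(* The two directional derivatives are the partial derivatives of V, applied to the respective
   right-hand sides. *)
definition practical_simulation_function ::
    "('x::euclidean_space \<Rightarrow> 'u::euclidean_space \<Rightarrow> 'x) \<Rightarrow> ('x \<Rightarrow> 'o::euclidean_space) \<Rightarrow>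
     ('y::euclidean_space \<Rightarrow> 'w::euclidean_space \<Rightarrow> 'y) \<Rightarrow> ('y \<Rightarrow> 'o) \<Rightarrow>
     ('x \<Rightarrow> 'y \<Rightarrow> real) \<Rightarrow> bool" where
  "practical_simulation_function f h fh hh V \<longleftrightarrow>
     continuously_differentiable (\<lambda>(x, xh). V x xh) \<and>
     (\<forall>x xh. 0 \<le> V x xh) \<and>
     (\<exists>(v :: 'x \<Rightarrow> 'y \<Rightarrow> 'w \<Rightarrow> 'u) \<nu> \<eta> \<rho> (\<Delta> :: 'y \<Rightarrow> real).
        locally_lipschitz (\<lambda>(x, xh, uh). v x xh uh) \<and>
        class_K_inf \<nu> \<and> class_K_inf \<eta> \<and> class_K_or_zero \<rho> \<and> (\<forall>xh. 0 \<le> \<Delta> xh) \<and>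
        (\<forall>x xh uh.
           \<nu> (norm (h x - hh xh)) \<le> V x xh \<and>
           frechet_derivative (\<lambda>z. V z xh) (at x) (f x (v x xh uh))
             + frechet_derivative (\<lambda>z. V x z) (at xh) (fh xh uh)
             \<le> - \<eta> (V x xh) + \<rho> (norm uh) + \<Delta> xh))"

subsection \<open>Interconnected systems\<close>

definition agent_dynamics ::
    "(real^'n \<Rightarrow> real^'n) \<Rightarrow> (real^'n \<Rightarrow> real^'m^'n) \<Rightarrow> real^'p^'n \<Rightarrow>
     real^'n \<Rightarrow> real^'m \<Rightarrow> real^'p \<Rightarrow> real^'n" where
  "agent_dynamics \<alpha> \<beta> B x u w = \<alpha> x + \<beta> x *v u + B *v w"

definition interconnection_input ::
    "real^'k^'k \<Rightarrow> real^'n^'p \<Rightarrow> real^'n^'k \<Rightarrow> real^'p^'k" where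
  "interconnection_input M C x =
     unstack ((M \<otimes>\<^sub>K (mat 1 :: real^'p^'p)) *v stack (\<chi> i. C *v (x $ i)))"

definition interconnected_dynamics ::
    "('k \<Rightarrow> real^'n \<Rightarrow> real^'m \<Rightarrow> real^'p \<Rightarrow> real^'n) \<Rightarrow> real^'k^'k \<Rightarrow> real^'n^'p \<Rightarrow>
     real^'n^'k \<Rightarrow> real^'m^'k \<Rightarrow> real^'n^'k" where
  "interconnected_dynamics g M C x u =
     (\<chi> i. g i (x $ i) (u $ i) (interconnection_input M C x $ i))"

(* grp l is the group of agent l. Surjectivity: no group is empty. Monotonicity: the agents are
   numbered group by group. *)
definition agent_partition ::
    "('l::{finite,linorder} \<Rightarrow> 'g::{finite,linorder}) \<Rightarrow> bool" where
  "agent_partition grp \<longleftrightarrow> surj grp \<and> mono grp"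

definition partition_matrix :: "('l \<Rightarrow> 'g) \<Rightarrow> real^'g^'l" where
  "partition_matrix grp = (\<chi> l i. if grp l = i then 1 else 0)"

definition concrete_output :: "real^'n^'l \<Rightarrow> real^'n^'l" where
  "concrete_output x = x"

(* Block i of the state is repeated once for each agent of group i. *)
definition aggregate_output :: "('l \<Rightarrow> 'g) \<Rightarrow> real^'n^'g \<Rightarrow> real^'n^'l" where
  "aggregate_output grp xh = (\<chi> l. xh $ grp l)"

definition agent_V :: "real^'n^'n \<Rightarrow> real^'n \<Rightarrow> real^'n \<Rightarrow> real" where
  "agent_V Q x xh = 1/2 * ((x - xh) \<bullet> (Q *v (x - xh)))"

definition group_V ::
    "('l \<Rightarrow> real^'n^'n) \<Rightarrow> ('l \<Rightarrow> 'g) \<Rightarrow> 'g \<Rightarrow> real^'n^'l \<Rightarrow> real^'n \<Rightarrow> real" where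
  "group_V Q grp i x xh = (\<Sum>l | grp l = i. agent_V (Q l) (x $ l) xh)"

definition composite_V ::
    "('g \<Rightarrow> real) \<Rightarrow> ('l \<Rightarrow> real^'n^'n) \<Rightarrow> ('l \<Rightarrow> 'g) \<Rightarrow> real^'n^'l \<Rightarrow> real^'n^'g \<Rightarrow> real" where
  "composite_V \<mu> Q grp x xh = (\<Sum>i\<in>UNIV. \<mu> i * group_V Q grp i x (xh $ i))"

subsection \<open>The linear matrix inequality\<close>

definition supply_matrix :: "real^('a::finite + 'a)^('a + 'a)" where
  "supply_matrix = (1/2) *\<^sub>R block_mat 0 (mat 1) (mat 1) 0"

definition relaxed_lmi ::
    "real^'l^'l \<Rightarrow> real^'g^'l \<Rightarrow> real^('g \<times> 'p::finite)^('g \<times> 'p) \<Rightarrow> bool" where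
  "relaxed_lmi M Y Z \<longleftrightarrow>
     (let W = block_mat (Y \<otimes>\<^sub>K (mat 1 :: real^'p^'p)) (M \<otimes>\<^sub>K (mat 1 :: real^'p^'p)) 0 (mat 1)
      in transpose W ** supply_matrix ** W - block_mat Z 0 0 0 \<preceq> 0)"

end

theory Submission
  imports Defs
begin

text \<open>
  Quantities of the aggregate system carry the suffix \<open>h\<close>. Write \<open>e\<^sub>l = x\<^sub>l - xh\<^sub>i\<close> for the deviation
  of agent \<open>l\<close> from the aggregate state of its group \<open>i\<close>, and let every agent use the interface
  \<open>v\<^sub>l(x\<^sub>l, xh\<^sub>i, uh\<^sub>i)\<close>. The composite function is \<open>V = \<Sum>\<^sub>l e\<^sub>l\<^sup>T Q\<^sub>l e\<^sub>l / 2\<close>, and its derivative along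
  both systems is the sum of four contributions per agent.

  \<^item> The increment \<open>\<alpha>\<^sub>l(x\<^sub>l) - \<alpha>\<^sub>l(xh\<^sub>i)\<close> contributes at most \<open>\<lambda>\<^sub>l |e\<^sub>l|\<^sup>2\<close>, by the mean value theorem
    along the segment joining the two states (\<open>contraction_from_jacobian_bound\<close>).
  \<^item> The heterogeneity \<open>\<alpha>\<^sub>l(xh\<^sub>i) - \<alpha>(xh\<^sub>i)\<close> depends on \<open>xh\<close> only, so Young's inequality trades it for
    half of the margin \<open>-(\<lambda>\<^sub>l + \<theta>\<^sub>l) |e\<^sub>l|\<^sup>2\<close> and a term that goes into \<open>\<Delta>(xh)\<close>.
  \<^item> The inputs contribute at most \<open>\<theta>\<^sub>l |e\<^sub>l|\<^sup>2 + \<rho>\<^sub>l(|uh\<^sub>i|)\<close>.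
  \<^item> Since \<open>Q\<^sub>l B = C\<^sup>T\<close>, the interconnections contribute \<open>(C e\<^sub>l)\<^sup>T (w\<^sub>l - wh\<^sub>i)\<close>.

  The last contribution couples the agents, and only its sum over all of them is controlled. With
  \<open>d = [C e\<^sub>1; \<dots>]\<close> and \<open>\<xi> = [C xh\<^sub>1; \<dots>]\<close>, and with the Kronecker factors \<open>I\<close> suppressed, the stacked
  mismatch of the internal inputs is \<open>Y \<xi> + M d\<close> (\<open>stack_input_mismatch\<close>), and the linear matrix
  inequality says exactly that \<open>(Y \<xi> + M d)\<^sup>T d \<le> \<xi>\<^sup>T Z \<xi>\<close> for all \<open>\<xi>\<close> and \<open>d\<close>
  (\<open>relaxed_lmi_iff\<close>). The right-hand side is again a function of \<open>xh\<close>. What remains is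
  \<open>- c \<Sum>\<^sub>l |e\<^sub>l|\<^sup>2 / 2\<close>, where \<open>c\<close> is the smallest margin, and this is at most a negative multiple of
  \<open>V\<close>. Thus \<open>\<nu>\<close> is quadratic, \<open>\<eta>\<close> is linear and \<open>\<rho>\<close> is the sum of the \<open>\<rho>\<^sub>l\<close>.

  Solvability of the inequality is a question about \<open>S = -(M + M\<^sup>T)/2 \<ge> 0\<close>. On the null space of
  \<open>S\<close> the form \<open>d\<^sup>T M d\<close> vanishes, so the term \<open>(Y \<xi>)\<^sup>T d\<close>, which is linear in \<open>d\<close>, must vanish
  there as well: this is necessity. Conversely, the inclusion of null spaces means that the range
  of \<open>Y\<close> lies in that of \<open>S\<close>, say \<open>Y = S W\<close>, and completing the square in \<open>S\<close> gives
  \<open>Z = (W\<^sup>T S W / 4) \<otimes> I\<close>. An equitable partition is the case \<open>Y = 0\<close>, in which the inclusion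
  holds trivially; so the first claim is reduced to the linear matrix inequality, too.
\<close>

section \<open>Quadratic forms\<close>

lemma inner_matrix_vector_transpose:
  fixes A :: "real^'a^'b"
  shows "x \<bullet> (A *v y) = (transpose A *v x) \<bullet> y"
  by (simp add: dot_lmul_matrix)

lemma inner_matrix_vector_symmetric:
  fixes A :: "real^'a^'a"
  assumes "transpose A = A"
  shows "x \<bullet> (A *v y) = (A *v x) \<bullet> y"
  by (subst inner_matrix_vector_transpose) (simp add: assms)

lemma pos_def_lower_bound:
  fixes Q :: "real^'n^'n"
  assumes "pos_def Q"
  obtains k where "k > 0" "\<And>x. k * (norm x)\<^sup>2 \<le> x \<bullet> (Q *v x)"
proof -
  have cont: "continuous_on (sphere 0 1) (\<lambda>x. x \<bullet> (Q *v x))"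
    by (intro continuous_intros linear_continuous_on matrix_vector_mul_bounded_linear)
  have ne: "sphere (0::real^'n) 1 \<noteq> {}" by simp
  obtain m where m: "m \<in> sphere 0 1" "\<And>y. y \<in> sphere 0 1 \<Longrightarrow> m \<bullet> (Q *v m) \<le> y \<bullet> (Q *v y)"
    using continuous_attains_inf[OF compact_sphere ne cont] by blast
  have "m \<noteq> 0" using m(1) by auto
  then have "m \<bullet> (Q *v m) > 0" using assms by (simp add: pos_def_def)
  moreover have "(m \<bullet> (Q *v m)) * (norm x)\<^sup>2 \<le> x \<bullet> (Q *v x)" for x
  proof (cases "x = 0")
    case False
    define y where "y = x /\<^sub>R norm x"
    have "y \<in> sphere 0 1" using False by (simp add: y_def)
    then have "m \<bullet> (Q *v m) \<le> y \<bullet> (Q *v y)" by (rule m(2))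
    also have "\<dots> = (x \<bullet> (Q *v x)) / (norm x)\<^sup>2"
      by (simp add: y_def matrix_vector_mult_scaleR power2_eq_square field_simps)
    finally show ?thesis using False by (simp add: field_simps)
  qed simp
  ultimately show ?thesis using that by blast
qed

lemma quadratic_form_upper_bound:
  fixes Q :: "real^'n^'n"
  obtains K where "K > 0" "\<And>x. x \<bullet> (Q *v x) \<le> K * (norm x)\<^sup>2"
proof -
  obtain K where K: "K > 0" "\<And>x. norm (Q *v x) \<le> norm x * K"
    using bounded_linear.pos_bounded[OF matrix_vector_mul_bounded_linear] by blast
  have "x \<bullet> (Q *v x) \<le> K * (norm x)\<^sup>2" for x
  proof -
    have "x \<bullet> (Q *v x) \<le> norm x * norm (Q *v x)" by (rule norm_cauchy_schwarz)
    also have "\<dots> \<le> norm x * (norm x * K)" by (intro mult_left_mono K) simp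
    finally show ?thesis by (simp add: power2_eq_square ac_simps)
  qed
  then show ?thesis using that K(1) by blast
qed

lemma finite_family_lower_bound:
  fixes f :: "'l::finite \<Rightarrow> real"
  assumes "\<And>l. f l > 0"
  obtains k where "k > 0" "\<And>l. k \<le> f l"
proof
  show "Min (range f) > 0" using assms by simp
  show "Min (range f) \<le> f l" for l by simp
qed

lemma finite_family_upper_bound:
  fixes f :: "'l::finite \<Rightarrow> real"
  assumes "\<And>l. f l > 0"
  obtains k where "k > 0" "\<And>l. f l \<le> k"
proof
  have "f undefined \<le> Max (range f)" by simp
  with assms[of undefined] show "Max (range f) > 0" by linarith
  show "f l \<le> Max (range f)" for l by simp
qed

text \<open>
  Constants common to all agents are what allows the composite function, a sum over the agents, to
  be compared with the squared output error.
\<close>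

lemma uniform_quadratic_form_bounds:
  fixes Q :: "'l::finite \<Rightarrow> real^'n^'n"
  assumes "\<And>l. pos_def (Q l)"
  obtains k K where "k > 0" "\<And>l x. k * (norm x)\<^sup>2 \<le> x \<bullet> (Q l *v x)"
    and "K > 0" "\<And>l x. x \<bullet> (Q l *v x) \<le> K * (norm x)\<^sup>2"
proof -
  have "\<forall>l. \<exists>k. k > 0 \<and> (\<forall>x. k * (norm x)\<^sup>2 \<le> x \<bullet> (Q l *v x))"
    by (rule allI, rule pos_def_lower_bound[OF assms]) blast
  from choice[OF this] obtain kl
    where kl: "\<forall>l. kl l > 0 \<and> (\<forall>x. kl l * (norm x)\<^sup>2 \<le> x \<bullet> (Q l *v x))" ..
  have "\<forall>l. \<exists>K. K > 0 \<and> (\<forall>x. x \<bullet> (Q l *v x) \<le> K * (norm x)\<^sup>2)"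
    by (rule allI, rule quadratic_form_upper_bound) blast
  from choice[OF this] obtain Kl
    where Kl: "\<forall>l. Kl l > 0 \<and> (\<forall>x. x \<bullet> (Q l *v x) \<le> Kl l * (norm x)\<^sup>2)" ..
  have pos: "kl l > 0" "Kl l > 0" for l using kl Kl by simp_all
  obtain k where k: "k > 0" "\<And>l. k \<le> kl l" using finite_family_lower_bound[of kl, OF pos(1)] by blast
  obtain K where K: "K > 0" "\<And>l. Kl l \<le> K" using finite_family_upper_bound[of Kl, OF pos(2)] by blast
  show ?thesis
  proof (rule that[OF k(1) _ K(1)])
    fix l and x :: "real^'n"
    have "k * (norm x)\<^sup>2 \<le> kl l * (norm x)\<^sup>2" by (intro mult_right_mono k) simp
    then show "k * (norm x)\<^sup>2 \<le> x \<bullet> (Q l *v x)" using kl order_trans by blast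
    have "Kl l * (norm x)\<^sup>2 \<le> K * (norm x)\<^sup>2" by (intro mult_right_mono K) simp
    then show "x \<bullet> (Q l *v x) \<le> K * (norm x)\<^sup>2" using Kl order_trans by blast
  qed
qed

text \<open>
  The scalar function \<open>t \<mapsto> e\<^sup>T Q f(y + t e)\<close> with \<open>e = x - y\<close> has derivative \<open>e\<^sup>T Q J e\<close>, where \<open>J\<close>
  is the Jacobian of \<open>f\<close> at \<open>y + t e\<close>, and a quadratic form only sees the symmetric part of \<open>Q J\<close>, which the hypothesis bounds by \<open>c I\<close>.
\<close>

lemma contraction_from_jacobian_bound:
  fixes f :: "real^'n \<Rightarrow> real^'n" and Q :: "real^'n^'n"
  assumes diff: "\<And>z. f differentiable at z"
    and sym: "transpose Q = Q"
    and bound: "\<And>z. Q ** jacobian f (at z) + transpose (jacobian f (at z)) ** Q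
                      \<preceq> (2 * c) *\<^sub>R mat 1"
  shows "(x - y) \<bullet> (Q *v (f x - f y)) \<le> c * (norm (x - y))\<^sup>2"
proof -
  define e where "e = x - y"
  define \<phi> where "\<phi> t = (Q *v e) \<bullet> f (y + t *\<^sub>R e)" for t
  define \<phi>' where "\<phi>' t = (Q *v e) \<bullet> (jacobian f (at (y + t *\<^sub>R e)) *v e)" for t
  have der: "(f has_derivative (\<lambda>h. jacobian f (at z) *v h)) (at z)" for z
    using diff[of z] jacobian_works by blast
  have "DERIV \<phi> t :> \<phi>' t" for t
  proof -
    have "((\<lambda>t. f (y + t *\<^sub>R e)) has_derivative
            (\<lambda>h. jacobian f (at (y + t *\<^sub>R e)) *v (h *\<^sub>R e))) (at t)"
      by (rule has_derivative_compose[OF _ der]) (auto intro!: derivative_eq_intros)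
    then have "(\<phi> has_derivative
            (\<lambda>h. (Q *v e) \<bullet> (jacobian f (at (y + t *\<^sub>R e)) *v (h *\<^sub>R e)))) (at t)"
      unfolding \<phi>_def by (rule has_derivative_inner_right)
    then show ?thesis
      by (simp add: has_field_derivative_def \<phi>'_def matrix_vector_mult_scaleR mult_commute_abs)
  qed
  then obtain t where "\<phi> 1 - \<phi> 0 = (1 - 0) * \<phi>' t"
    using MVT2[of 0 1 \<phi> \<phi>'] by auto
  moreover have "\<phi>' t \<le> c * (norm e)\<^sup>2"
  proof -
    define J where "J = jacobian f (at (y + t *\<^sub>R e))"
    have "0 \<le> e \<bullet> (((2 * c) *\<^sub>R mat 1 - (Q ** J + transpose J ** Q)) *v e)"
      using bound[of "y + t *\<^sub>R e"] by (simp add: semidef_le_def pos_semidef_def J_def)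
    also have "\<dots> = 2 * c * (e \<bullet> e) - (e \<bullet> (Q *v (J *v e)) + e \<bullet> (transpose J *v (Q *v e)))"
      by (simp add: matrix_vector_mult_diff_rdistrib matrix_vector_mult_add_rdistrib
          inner_diff_right inner_add_right matrix_vector_mul_assoc
          scaleR_matrix_vector_assoc[symmetric])
    also have "e \<bullet> (transpose J *v (Q *v e)) = (Q *v e) \<bullet> (J *v e)"
      by (subst inner_matrix_vector_transpose) (simp add: inner_commute)
    also have "e \<bullet> (Q *v (J *v e)) = (Q *v e) \<bullet> (J *v e)"
      by (rule inner_matrix_vector_symmetric[OF sym])
    finally show ?thesis by (simp add: \<phi>'_def J_def dot_square_norm)
  qed
  moreover have "\<phi> 1 - \<phi> 0 = e \<bullet> (Q *v (f x - f y))"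
    by (simp add: inner_matrix_vector_symmetric[OF sym] \<phi>_def e_def inner_diff_right)
  ultimately show ?thesis by (simp add: e_def)
qed

section \<open>Kronecker products with an identity factor\<close>

text \<open>
  Under \<open>A \<otimes> I\<^sub>q\<close> the coordinates with a fixed second index do not interact: each slice is
  multiplied by \<open>A\<close>. Statements about the Kronecker product are therefore reduced to statements
  about \<open>A\<close> by slicing.
\<close>

definition slice :: "'q::finite \<Rightarrow> real^('k \<times> 'q) \<Rightarrow> real^'k" where
  "slice q y = (\<chi> i. y $ (i, q))"

lemma inner_eq_sum_slices:
  fixes a b :: "real^('k::finite \<times> 'q::finite)"
  shows "a \<bullet> b = (\<Sum>q\<in>UNIV. slice q a \<bullet> slice q b)"
proof -
  have "a \<bullet> b = (\<Sum>r\<in>UNIV \<times> UNIV. a $ r * b $ r)" by (simp add: inner_vec_def)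
  also have "\<dots> = (\<Sum>i\<in>UNIV. \<Sum>q\<in>UNIV. a $ (i, q) * b $ (i, q))"
    by (simp only: sum.cartesian_product) (simp add: case_prod_beta)
  also have "\<dots> = (\<Sum>q\<in>UNIV. \<Sum>i\<in>UNIV. a $ (i, q) * b $ (i, q))" by (rule sum.swap)
  finally show ?thesis by (simp add: inner_vec_def slice_def)
qed

lemma kron_mat_1_mult_nth:
  fixes A :: "real^'a^'b" and y :: "real^('a \<times> 'q::finite)"
  shows "((A \<otimes>\<^sub>K (mat 1 :: real^'q^'q)) *v y) $ (i, q) = (\<Sum>j\<in>UNIV. A $ i $ j * y $ (j, q))"
proof -
  have "((A \<otimes>\<^sub>K (mat 1 :: real^'q^'q)) *v y) $ (i, q)
          = (\<Sum>r\<in>UNIV \<times> UNIV. A $ i $ fst r * (mat 1 :: real^'q^'q) $ q $ snd r * y $ r)"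
    by (simp add: matrix_vector_mult_def kron_def)
  also have "\<dots> = (\<Sum>j\<in>UNIV. \<Sum>s\<in>UNIV. A $ i $ j * (mat 1 :: real^'q^'q) $ q $ s * y $ (j, s))"
    by (simp only: sum.cartesian_product) (simp add: case_prod_beta)
  also have "\<dots> = (\<Sum>j\<in>UNIV. \<Sum>s\<in>UNIV. if s = q then A $ i $ j * y $ (j, q) else 0)"
    by (intro sum.cong refl) (auto simp: mat_def)
  finally show ?thesis by simp
qed

lemma slice_kron_mat_1:
  fixes A :: "real^'a^'b" and y :: "real^('a \<times> 'q::finite)"
  shows "slice q ((A \<otimes>\<^sub>K (mat 1 :: real^'q^'q)) *v y) = A *v slice q y"
  unfolding vec_eq_iff by (simp add: slice_def kron_mat_1_mult_nth) (simp add: matrix_vector_mult_def)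

definition repeat_slice :: "real^'k \<Rightarrow> real^('k \<times> 'q::finite)" where
  "repeat_slice v = (\<chi> r. v $ fst r)"

lemma slice_repeat_slice: "slice q (repeat_slice v) = v"
  by (simp add: slice_def repeat_slice_def)

lemma slice_add: "slice q (a + b) = slice q a + slice q b"
  by (simp add: slice_def vec_eq_iff)

lemma pos_semidef_kron_mat_1:
  fixes A :: "real^'a^'a"
  assumes "pos_semidef A"
  shows "pos_semidef (A \<otimes>\<^sub>K (mat 1 :: real^'q^'q))"
  unfolding pos_semidef_def
proof
  have "transpose A $ i $ j = A $ i $ j" for i j
    using assms by (simp add: pos_semidef_def)
  then have "A $ j $ i = A $ i $ j" for i j
    by (simp add: transpose_def)
  then show "transpose (A \<otimes>\<^sub>K (mat 1 :: real^'q^'q)) = A \<otimes>\<^sub>K mat 1"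
    by (auto simp: vec_eq_iff transpose_def kron_def mat_def)
  show "\<forall>x. 0 \<le> x \<bullet> ((A \<otimes>\<^sub>K (mat 1 :: real^'q^'q)) *v x)"
    using assms by (auto simp: inner_eq_sum_slices slice_kron_mat_1 pos_semidef_def intro!: sum_nonneg)
qed

section \<open>The linear matrix inequality as an inequality between quadratic forms\<close>

definition join :: "real^'a \<Rightarrow> real^'b \<Rightarrow> real^('a + 'b)" where
  "join a b = (\<chi> r. case r of Inl i \<Rightarrow> a $ i | Inr j \<Rightarrow> b $ j)"

lemma sum_UNIV_Plus:
  fixes f :: "'a::finite + 'b::finite \<Rightarrow> real"
  shows "sum f UNIV = (\<Sum>i\<in>UNIV. f (Inl i)) + (\<Sum>j\<in>UNIV. f (Inr j))"
  unfolding UNIV_Plus_UNIV[symmetric] by (subst sum.Plus) simp_all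

lemma inner_join: "join a b \<bullet> join c d = a \<bullet> c + b \<bullet> d"
  by (simp add: inner_vec_def join_def sum_UNIV_Plus)

lemma block_mat_mult_join:
  "block_mat A B C D *v join a b = join (A *v a + B *v b) (C *v a + D *v b)"
proof -
  have "(block_mat A B C D *v join a b) $ r = join (A *v a + B *v b) (C *v a + D *v b) $ r" for r
    by (cases r) (simp_all add: block_mat_def join_def matrix_vector_mult_def sum_UNIV_Plus)
  then show ?thesis by (simp add: vec_eq_iff)
qed

lemma join_surj: obtains a b where "x = join a b"
proof
  show "x = join (\<chi> i. x $ Inl i) (\<chi> j. x $ Inr j)"
    unfolding vec_eq_iff join_def by (simp split: sum.split)
qed

lemma transpose_block_mat:
  "transpose (block_mat A B C D)
     = block_mat (transpose A) (transpose C) (transpose B) (transpose D)"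
proof -
  have "transpose (block_mat A B C D) $ r $ s
      = block_mat (transpose A) (transpose C) (transpose B) (transpose D) $ r $ s" for r s
    by (cases r; cases s) (simp_all add: block_mat_def transpose_def)
  then show ?thesis by (simp add: vec_eq_iff)
qed

lemma transpose_linear:
  fixes A B :: "real^'a^'b"
  shows "transpose (0 :: real^'a^'b) = 0"
    and "transpose (A + B) = transpose A + transpose B"
    and "transpose (A - B) = transpose A - transpose B"
    and "transpose (- A) = - transpose A"
    and "transpose (c *\<^sub>R A) = c *\<^sub>R transpose A"
  by (simp_all add: vec_eq_iff transpose_def)

text \<open>
  Evaluated at \<open>[\<xi>; d]\<close>, the block matrix produces \<open>[Y \<xi> + M d; d]\<close>, on which the supply matrix
  computes the inner product of the two blocks.
\<close>

lemma relaxed_lmi_iff: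
  fixes M :: "real^'l^'l" and Y :: "real^'g^'l" and Z :: "real^('g \<times> 'p::finite)^('g \<times> 'p)"
  assumes "transpose Z = Z"
  shows "relaxed_lmi M Y Z \<longleftrightarrow>
    (\<forall>\<xi> d. ((Y \<otimes>\<^sub>K (mat 1 :: real^'p^'p)) *v \<xi> + (M \<otimes>\<^sub>K (mat 1 :: real^'p^'p)) *v d) \<bullet> d
            \<le> \<xi> \<bullet> (Z *v \<xi>))"
proof -
  define YY where "YY = Y \<otimes>\<^sub>K (mat 1 :: real^'p^'p)"
  define MM where "MM = M \<otimes>\<^sub>K (mat 1 :: real^'p^'p)"
  define W where "W = block_mat YY MM 0 (mat 1)"
  define X where "X = (supply_matrix :: real^('l \<times> 'p + 'l \<times> 'p)^('l \<times> 'p + 'l \<times> 'p))"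
  define F where "F = 0 - (transpose W ** X ** W - block_mat Z 0 0 0)"
  have "transpose X = X"
    by (simp add: X_def supply_matrix_def transpose_linear transpose_block_mat)
  then have symF: "transpose F = F"
    using assms
    by (simp add: F_def transpose_linear matrix_transpose_mul matrix_mul_assoc
        transpose_block_mat)
  have quad: "join \<xi> d \<bullet> (F *v join \<xi> d) = \<xi> \<bullet> (Z *v \<xi>) - (YY *v \<xi> + MM *v d) \<bullet> d" for \<xi> d
  proof -
    define w where "w = W *v join \<xi> d"
    have w: "w = join (YY *v \<xi> + MM *v d) d"
      by (simp add: w_def W_def block_mat_mult_join)
    have "X *v join a b = (1/2) *\<^sub>R join b a" for a b
      by (simp add: X_def supply_matrix_def scaleR_matrix_vector_assoc[symmetric] block_mat_mult_join)
    then have "w \<bullet> (X *v w) = (YY *v \<xi> + MM *v d) \<bullet> d"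
      by (simp add: w inner_join inner_commute)
    moreover have "join \<xi> d \<bullet> ((transpose W ** X ** W) *v join \<xi> d) = w \<bullet> (X *v w)"
      by (simp add: w_def matrix_vector_mul_assoc[symmetric] inner_matrix_vector_transpose[of _ "transpose W"]
          del: transpose_matrix_vector)
    moreover have "F *v join \<xi> d
        = block_mat Z 0 0 0 *v join \<xi> d - (transpose W ** X ** W) *v join \<xi> d"
      by (simp add: F_def matrix_vector_mult_diff_rdistrib)
    ultimately show ?thesis
      by (simp add: inner_diff_right block_mat_mult_join inner_join)
  qed
  have "relaxed_lmi M Y Z \<longleftrightarrow> pos_semidef F"
    by (simp add: relaxed_lmi_def semidef_le_def F_def W_def X_def YY_def MM_def Let_def)
  also have "\<dots> \<longleftrightarrow> (\<forall>x. 0 \<le> x \<bullet> (F *v x))"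
    by (simp add: pos_semidef_def symF)
  also have "\<dots> \<longleftrightarrow> (\<forall>\<xi> d. 0 \<le> join \<xi> d \<bullet> (F *v join \<xi> d))"
  proof (intro iffI allI)
    fix x :: "real^('g \<times> 'p + 'l \<times> 'p)"
    assume "\<forall>\<xi> d. 0 \<le> join \<xi> d \<bullet> (F *v join \<xi> d)"
    moreover obtain \<xi> d where "x = join \<xi> d" by (rule join_surj)
    ultimately show "0 \<le> x \<bullet> (F *v x)" by simp
  qed simp
  finally show ?thesis by (simp add: quad YY_def MM_def)
qed

section \<open>Solvability of the linear matrix inequality\<close>

text \<open>
  The range of a symmetric matrix is the orthogonal complement of its null space. The columns of
  \<open>Y\<close> are orthogonal to the null space of \<open>Y\<^sup>T\<close>, hence to that of \<open>S\<close>, so each of them is attained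
  by \<open>S\<close>; the preimages are the columns of \<open>W\<close>.
\<close>

lemma matrix_factor_through_symmetric:
  fixes S :: "real^'l^'l" and Y :: "real^'g^'l"
  assumes sym: "transpose S = S" and sub: "null_space S \<subseteq> null_space (transpose Y)"
  obtains W where "S ** W = Y"
proof -
  have adj: "adjoint ((*v) S) = (*v) S"
    by (simp add: adjoint_matrix sym)
  have ker: "null_space S = (range ((*v) S))\<^sup>\<bottom>"
    using ker_orthogonal_comp_adjoint[OF matrix_vector_mul_linear[of S]] adj
    by (auto simp: null_space_def)
  have range: "(null_space S)\<^sup>\<bottom> = range ((*v) S)"
    unfolding ker by (rule orthogonal_comp_self) (simp add: linear_subspace_image)
  have "Y *v v \<in> range ((*v) S)" for v
  proof -
    have "orthogonal d (Y *v v)" if "d \<in> null_space S" for d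
    proof -
      have "transpose Y *v d = 0" using that sub by (auto simp: null_space_def)
      then show ?thesis by (simp add: orthogonal_def inner_matrix_vector_transpose)
    qed
    then show ?thesis unfolding range[symmetric] orthogonal_comp_def by auto
  qed
  then have "\<forall>j. \<exists>w. S *v w = column j Y"
    by (metis imageE matrix_vector_mult_basis)
  then obtain w where w: "\<And>j. S *v w j = column j Y" by metis
  have "S ** (\<chi> i j. w j $ i) = Y"
    using w by (simp add: vec_eq_iff matrix_matrix_mult_def matrix_vector_mult_def column_def)
  then show ?thesis using that by blast
qed

lemma inner_symmetric_part:
  fixes M :: "real^'l^'l"
  shows "d \<bullet> ((M + transpose M) *v d) = 2 * ((M *v d) \<bullet> d)"
proof -
  have "d \<bullet> (transpose M *v d) = (M *v d) \<bullet> d"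
    by (subst inner_matrix_vector_transpose) simp
  then show ?thesis
    by (simp add: matrix_vector_mult_add_rdistrib inner_add_right inner_commute[of d "M *v d"]
        del: transpose_matrix_vector)
qed

text \<open>
  Let \<open>d\<close> be in the null space of \<open>M + M\<^sup>T\<close>. The inequality is tested on lifts to the Kronecker space in
  which every slice is the same. Along \<open>t d\<close>, and for the fixed \<open>\<xi> = Y\<^sup>T d\<close>, its left-hand side is
  linear in \<open>t\<close> with a slope proportional to \<open>|Y\<^sup>T d|\<^sup>2\<close>, while its right-hand side is constant.
\<close>

lemma null_space_inclusion_of_relaxed_lmi:
  fixes M :: "real^'l^'l" and Y :: "real^'g^'l" and Z :: "real^('g \<times> 'p::finite)^('g \<times> 'p)"
  assumes Z: "transpose Z = Z" and lmi: "relaxed_lmi M Y Z"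
  shows "null_space (M + transpose M) \<subseteq> null_space (transpose Y)"
proof
  fix d assume "d \<in> null_space (M + transpose M)"
  then have "(M *v d) \<bullet> d = 0"
    using inner_symmetric_part[of d M] by (simp add: null_space_def)
  define y where "y = transpose Y *v d"
  have "(Y *v y) \<bullet> d = y \<bullet> y"
    by (simp add: y_def inner_commute inner_matrix_vector_transpose[of d Y] del: transpose_matrix_vector)
  have bound: "t * (real CARD('p) * (y \<bullet> y)) \<le> repeat_slice y \<bullet> (Z *v repeat_slice y)" for t :: real
  proof -
    have "((Y \<otimes>\<^sub>K (mat 1 :: real^'p^'p)) *v repeat_slice y
            + (M \<otimes>\<^sub>K (mat 1 :: real^'p^'p)) *v repeat_slice (t *\<^sub>R d)) \<bullet> repeat_slice (t *\<^sub>R d)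
          = real CARD('p) * ((Y *v y + M *v (t *\<^sub>R d)) \<bullet> (t *\<^sub>R d))"
      by (simp add: inner_eq_sum_slices slice_add slice_kron_mat_1 slice_repeat_slice)
    also have "(Y *v y + M *v (t *\<^sub>R d)) \<bullet> (t *\<^sub>R d) = t * (y \<bullet> y)"
      using \<open>(M *v d) \<bullet> d = 0\<close> \<open>(Y *v y) \<bullet> d = y \<bullet> y\<close>
      by (simp add: matrix_vector_mult_scaleR inner_add_left)
    finally show ?thesis
      using lmi[unfolded relaxed_lmi_iff[OF Z], rule_format, of "repeat_slice y" "repeat_slice (t *\<^sub>R d)"]
      by (simp add: ac_simps)
  qed
  have "y \<bullet> y = 0"
  proof (rule ccontr)
    assume "y \<bullet> y \<noteq> 0"
    \<comment> \<open>At this \<open>t\<close> the left-hand side exceeds the constant right-hand side by one.\<close>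
    then show False
      using bound[of "(repeat_slice y \<bullet> (Z *v repeat_slice y) + 1) / (real CARD('p) * (y \<bullet> y))"]
      by simp
  qed
  then show "d \<in> null_space (transpose Y)"
    by (simp add: null_space_def y_def)
qed

text \<open>
  With \<open>Y = S W\<close>, the inequality \<open>(S W \<xi>)\<^sup>T d - d\<^sup>T S d \<le> (W \<xi>)\<^sup>T S (W \<xi>) / 4\<close> is nonnegativity of the
  form of \<open>S\<close> at \<open>W \<xi> / 2 - d\<close>.
\<close>

lemma relaxed_lmi_of_null_space_inclusion:
  fixes M :: "real^'l^'l" and Y :: "real^'g^'l"
  assumes neg: "M + transpose M \<preceq> 0"
    and sub: "null_space (M + transpose M) \<subseteq> null_space (transpose Y)"
  shows "\<exists>Z :: real^('g \<times> 'p::finite)^('g \<times> 'p). pos_semidef Z \<and> relaxed_lmi M Y Z"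
proof -
  define S where "S = (- 1 / 2) *\<^sub>R (M + transpose M)"
  have symS: "transpose S = S"
    by (simp add: S_def transpose_linear add.commute)
  have S_mult: "S *v d = (- 1 / 2) *\<^sub>R ((M + transpose M) *v d)" for d
    by (simp only: S_def scaleR_matrix_vector_assoc)
  have S_quad: "d \<bullet> (S *v d) = - ((M *v d) \<bullet> d)" for d
    using inner_symmetric_part[of d M] by (simp add: S_mult)
  have S_nonneg: "0 \<le> d \<bullet> (S *v d)" for d
  proof -
    have "0 \<le> d \<bullet> ((0 - (M + transpose M)) *v d)"
      using neg unfolding semidef_le_def pos_semidef_def by blast
    then show ?thesis
      unfolding matrix_vector_mult_diff_rdistrib by (simp add: S_mult inner_diff_right)
  qed
  have "null_space S = null_space (M + transpose M)"
    by (auto simp: null_space_def S_mult)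
  with sub obtain W where W: "S ** W = Y"
    using matrix_factor_through_symmetric[OF symS] by metis
  define A where "A = (1 / 4) *\<^sub>R (transpose W ** S ** W)"
  have A_quad: "x \<bullet> (A *v x) = (1 / 4) * ((W *v x) \<bullet> (S *v (W *v x)))" for x
    by (simp add: A_def scaleR_matrix_vector_assoc[symmetric] matrix_vector_mul_assoc[symmetric]
        inner_matrix_vector_transpose[of _ "transpose W"] del: transpose_matrix_vector)
  have A_psd: "pos_semidef A"
    unfolding pos_semidef_def A_quad using S_nonneg
    by (auto simp: A_def transpose_linear matrix_transpose_mul symS matrix_mul_assoc)
  have le: "(Y *v x + M *v d) \<bullet> d \<le> x \<bullet> (A *v x)" for x d
  proof -
    define w where "w = (1 / 2) *\<^sub>R (W *v x)"
    have "0 \<le> (w - d) \<bullet> (S *v (w - d))" by (rule S_nonneg)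
    also have "\<dots> = w \<bullet> (S *v w) - 2 * ((S *v w) \<bullet> d) + d \<bullet> (S *v d)"
      using inner_matrix_vector_symmetric[OF symS, of w d]
      by (simp add: matrix_vector_mult_diff_distrib inner_diff_right inner_diff_left inner_commute)
    also have "w \<bullet> (S *v w) = x \<bullet> (A *v x)"
      by (simp add: w_def A_quad matrix_vector_mult_scaleR)
    also have "2 * ((S *v w) \<bullet> d) = (Y *v x) \<bullet> d"
      by (simp add: w_def matrix_vector_mult_scaleR matrix_vector_mul_assoc W)
    finally show ?thesis by (simp add: S_quad inner_add_left)
  qed
  define Z where "Z = A \<otimes>\<^sub>K (mat 1 :: real^'p^'p)"
  have "pos_semidef Z" unfolding Z_def by (rule pos_semidef_kron_mat_1[OF A_psd])
  moreover have "relaxed_lmi M Y Z"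
  proof -
    have "transpose Z = Z" using \<open>pos_semidef Z\<close> by (simp add: pos_semidef_def)
    then show ?thesis
      by (subst relaxed_lmi_iff)
        (auto simp: Z_def inner_eq_sum_slices slice_add slice_kron_mat_1 intro!: sum_mono le)
  qed
  ultimately show ?thesis by blast
qed

theorem relaxed_lmi_solvable_iff:
  fixes M :: "real^'l^'l" and Y :: "real^'g^'l"
  assumes "M + transpose M \<preceq> 0"
  shows "(\<exists>Z :: real^('g \<times> 'p::finite)^('g \<times> 'p). pos_semidef Z \<and> relaxed_lmi M Y Z) \<longleftrightarrow>
           null_space (M + transpose M) \<subseteq> null_space (transpose Y)"
  using relaxed_lmi_of_null_space_inclusion[OF assms] null_space_inclusion_of_relaxed_lmi
  unfolding pos_semidef_def by metis

section \<open>The coupling of the two interconnections\<close>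

lemma inner_stack: "stack a \<bullet> stack b = (\<Sum>i\<in>UNIV. a $ i \<bullet> b $ i)"
  by (simp add: inner_eq_sum_slices) (simp add: slice_def stack_def inner_vec_def, rule sum.swap)

lemma slice_stack: "slice q (stack x) = (\<chi> i. x $ i $ q)"
  by (simp add: slice_def stack_def)

lemma partition_matrix_mult: "partition_matrix grp *v c = (\<chi> l. c $ grp l)"
  by (simp add: vec_eq_iff partition_matrix_def matrix_vector_mult_def if_distrib
      if_distribR cong: if_cong)

lemma eq_slicesI:
  assumes "\<And>q. slice q a = slice q b"
  shows "a = b"
  using assms by (auto simp: vec_eq_iff slice_def)

lemma stack_interconnection_input:
  fixes M :: "real^'k^'k" and C :: "real^'n^'p"
  shows "stack (interconnection_input M C x)
           = (M \<otimes>\<^sub>K (mat 1 :: real^'p^'p)) *v stack (\<chi> i. C *v (x $ i))"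
  by (simp add: interconnection_input_def stack_def unstack_def vec_eq_iff)

text \<open>
  Replacing \<open>x\<^sub>l\<close> by \<open>xh\<^sub>i + e\<^sub>l\<close> in the internal input of the concrete system leaves \<open>M\<close> acting on the
  deviations. On the aggregate state the two interconnections differ by \<open>Y\<close>, the defect of
  equitability.
\<close>

lemma stack_input_mismatch:
  fixes M :: "real^'l^'l" and Mbar :: "real^'g^'g" and C :: "real^'n^'p" and grp :: "'l \<Rightarrow> 'g"
  defines "Y \<equiv> M ** partition_matrix grp - partition_matrix grp ** Mbar"
  shows "stack (\<chi> l. interconnection_input M C x $ l - interconnection_input Mbar C xh $ grp l)
           = (Y \<otimes>\<^sub>K (mat 1 :: real^'p^'p)) *v stack (\<chi> i. C *v (xh $ i))
             + (M \<otimes>\<^sub>K (mat 1 :: real^'p^'p)) *v stack (\<chi> l. C *v (x $ l - xh $ grp l))"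
proof (rule eq_slicesI)
  fix q
  define a where "a = slice q (stack (\<chi> l. C *v (x $ l)))"
  define c where "c = slice q (stack (\<chi> i. C *v (xh $ i)))"
  have "slice q (stack (\<chi> l. interconnection_input M C x $ l - interconnection_input Mbar C xh $ grp l))
      = slice q (stack (interconnection_input M C x))
        - partition_matrix grp *v slice q (stack (interconnection_input Mbar C xh))"
    by (simp add: partition_matrix_mult slice_stack vec_eq_iff)
  also have "\<dots> = M *v a - partition_matrix grp *v (Mbar *v c)"
    by (simp add: stack_interconnection_input slice_kron_mat_1 a_def c_def)
  also have "\<dots> = Y *v c + M *v (a - partition_matrix grp *v c)"
    by (simp add: Y_def matrix_vector_mult_diff_rdistrib matrix_vector_mult_diff_distrib
        matrix_vector_mul_assoc)
  also have "a - partition_matrix grp *v c = slice q (stack (\<chi> l. C *v (x $ l - xh $ grp l)))"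
    by (simp add: a_def c_def partition_matrix_mult slice_stack vec_eq_iff
        matrix_vector_mult_diff_distrib)
  finally show "slice q (stack (\<chi> l. interconnection_input M C x $ l - interconnection_input Mbar C xh $ grp l))
      = slice q ((Y \<otimes>\<^sub>K (mat 1 :: real^'p^'p)) *v stack (\<chi> i. C *v (xh $ i))
             + (M \<otimes>\<^sub>K (mat 1 :: real^'p^'p)) *v stack (\<chi> l. C *v (x $ l - xh $ grp l)))"
    by (simp add: slice_add slice_kron_mat_1 c_def)
qed

lemma coupling_supply_bound:
  fixes M :: "real^'l^'l" and Mbar :: "real^'g^'g" and C :: "real^'n^'p" and grp :: "'l \<Rightarrow> 'g"
    and Z :: "real^('g \<times> 'p)^('g \<times> 'p)"
  assumes "transpose Z = Z"
    and "relaxed_lmi M (M ** partition_matrix grp - partition_matrix grp ** Mbar) Z"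
  shows "(\<Sum>l\<in>UNIV. (C *v (x $ l - xh $ grp l))
             \<bullet> (interconnection_input M C x $ l - interconnection_input Mbar C xh $ grp l))
           \<le> stack (\<chi> i. C *v (xh $ i)) \<bullet> (Z *v stack (\<chi> i. C *v (xh $ i)))"
proof -
  have "(\<Sum>l\<in>UNIV. (C *v (x $ l - xh $ grp l))
             \<bullet> (interconnection_input M C x $ l - interconnection_input Mbar C xh $ grp l))
      = stack (\<chi> l. interconnection_input M C x $ l - interconnection_input Mbar C xh $ grp l)
          \<bullet> stack (\<chi> l. C *v (x $ l - xh $ grp l))"
    by (simp add: inner_stack inner_commute)
  also have "\<dots> \<le> stack (\<chi> i. C *v (xh $ i)) \<bullet> (Z *v stack (\<chi> i. C *v (xh $ i)))"
    unfolding stack_input_mismatch using assms relaxed_lmi_iff by blast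
  finally show ?thesis .
qed

section \<open>The composite storage function\<close>

lemma composite_V_eq_sum:
  fixes Q :: "'l::finite \<Rightarrow> real^'n^'n" and grp :: "'l \<Rightarrow> 'g::finite"
  shows "composite_V (\<lambda>i. 1) Q grp x xh = (\<Sum>l\<in>UNIV. agent_V (Q l) (x $ l) (xh $ grp l))"
proof -
  have "composite_V (\<lambda>i. 1) Q grp x xh
      = (\<Sum>i\<in>UNIV. \<Sum>l | l \<in> UNIV \<and> grp l = i. agent_V (Q l) (x $ l) (xh $ grp l))"
    unfolding composite_V_def group_V_def by (intro sum.cong refl) simp
  also have "\<dots> = (\<Sum>l\<in>UNIV. agent_V (Q l) (x $ l) (xh $ grp l))"
    by (rule sum.group) simp_all
  finally show ?thesis .
qed

lemma has_derivative_half_quadratic_form: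
  fixes Q :: "real^'n^'n"
  assumes "transpose Q = Q"
  shows "((\<lambda>e. 1 / 2 * (e \<bullet> (Q *v e))) has_derivative (\<lambda>h. (Q *v e) \<bullet> h)) (at e)"
proof -
  have Q: "((*v) Q has_derivative (*v) Q) (at e)"
    by (intro bounded_linear_imp_has_derivative matrix_vector_mul_bounded_linear)
  have "((\<lambda>e. 1 / 2 * (e \<bullet> (Q *v e)))
          has_derivative (\<lambda>h. 1 / 2 * (e \<bullet> (Q *v h) + h \<bullet> (Q *v e)))) (at e)"
    by (intro has_derivative_mult_right has_derivative_inner Q has_derivative_ident)
  then show ?thesis
    using inner_matrix_vector_symmetric[OF assms, of e] by (simp add: inner_commute)
qed

text \<open>
  The deviation is linear in the joint state, so the composite function is a sum of
  quadratic forms precomposed with bounded linear maps.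
\<close>

definition deviation :: "('l::finite \<Rightarrow> 'g::finite) \<Rightarrow> 'l \<Rightarrow> (real^'n^'l) \<times> (real^'n^'g) \<Rightarrow> real^'n" where
  "deviation grp l z = fst z $ l - snd z $ grp l"

lemma bounded_linear_deviation: "bounded_linear (deviation grp l)"
  unfolding deviation_def
  by (intro bounded_linear_sub bounded_linear_compose[OF bounded_linear_vec_nth]
      bounded_linear_fst bounded_linear_snd)

lemma composite_V_has_derivative:
  fixes Q :: "'l::finite \<Rightarrow> real^'n^'n" and grp :: "'l \<Rightarrow> 'g::finite"
  assumes "\<And>l. transpose (Q l) = Q l"
  shows "((\<lambda>(x, xh). composite_V (\<lambda>i. 1) Q grp x xh) has_derivative
           (\<lambda>h. \<Sum>l\<in>UNIV. (Q l *v deviation grp l z) \<bullet> deviation grp l h)) (at z)"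
proof -
  have "((\<lambda>z. \<Sum>l\<in>UNIV. 1 / 2 * (deviation grp l z \<bullet> (Q l *v deviation grp l z))) has_derivative
           (\<lambda>h. \<Sum>l\<in>UNIV. (Q l *v deviation grp l z) \<bullet> deviation grp l h)) (at z)"
    by (intro has_derivative_sum has_derivative_compose[OF bounded_linear_imp_has_derivative
          has_derivative_half_quadratic_form] bounded_linear_deviation assms)
  then show ?thesis
    by (simp add: composite_V_eq_sum agent_V_def deviation_def case_prod_unfold)
qed

lemma composite_V_continuously_differentiable:
  fixes Q :: "'l::finite \<Rightarrow> real^'n^'n" and grp :: "'l \<Rightarrow> 'g::finite"
  assumes "\<And>l. transpose (Q l) = Q l"
  shows "continuously_differentiable (\<lambda>(x, xh). composite_V (\<lambda>i. 1) Q grp x xh)"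
proof -
  define D where
    "D z = (\<Sum>l\<in>UNIV. blinfun_inner_right (Q l *v deviation grp l z) o\<^sub>L Blinfun (deviation grp l))"
    for z
  have "blinfun_apply (D z) = (\<lambda>h. \<Sum>l\<in>UNIV. (Q l *v deviation grp l z) \<bullet> deviation grp l h)" for z
    by (simp add: fun_eq_iff D_def blinfun.sum_left bounded_linear_Blinfun_apply[OF bounded_linear_deviation])
  then have "((\<lambda>(x, xh). composite_V (\<lambda>i. 1) Q grp x xh) has_derivative blinfun_apply (D z)) (at z)" for z
    using composite_V_has_derivative[OF assms] by simp
  moreover have "continuous_on UNIV D"
    unfolding D_def
    by (intro continuous_intros linear_continuous_on bounded_linear_deviation
        bounded_linear_compose[OF matrix_vector_mul_bounded_linear]
        bounded_linear_compose[OF bounded_linear_blinfun_inner_right])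
  ultimately show ?thesis unfolding continuously_differentiable_def by blast
qed

lemma composite_V_partial_derivatives:
  fixes Q :: "'l::finite \<Rightarrow> real^'n^'n" and grp :: "'l \<Rightarrow> 'g::finite"
  assumes "\<And>l. transpose (Q l) = Q l"
  shows "frechet_derivative (\<lambda>z. composite_V (\<lambda>i. 1) Q grp z xh) (at x) h
           + frechet_derivative (\<lambda>z. composite_V (\<lambda>i. 1) Q grp x z) (at xh) hh
         = (\<Sum>l\<in>UNIV. (Q l *v (x $ l - xh $ grp l)) \<bullet> (h $ l - hh $ grp l))"
proof -
  let ?V = "composite_V (\<lambda>i. 1) Q grp"
  note der = composite_V_has_derivative[of Q grp "(x, xh)", OF assms]
  have "((\<lambda>z. (z, xh)) has_derivative (\<lambda>h. (h, 0))) (at x)"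
    by (intro has_derivative_Pair has_derivative_ident has_derivative_const)
  from has_derivative_compose[OF this der]
  have "((\<lambda>z. ?V z xh) has_derivative
          (\<lambda>h. \<Sum>l\<in>UNIV. (Q l *v (x $ l - xh $ grp l)) \<bullet> (h $ l))) (at x)"
    by (simp add: deviation_def)
  moreover have "((\<lambda>z. (x, z)) has_derivative (\<lambda>h. (0, h))) (at xh)"
    by (intro has_derivative_Pair has_derivative_ident has_derivative_const)
  from has_derivative_compose[OF this der]
  have "((\<lambda>z. ?V x z) has_derivative
          (\<lambda>h. \<Sum>l\<in>UNIV. (Q l *v (x $ l - xh $ grp l)) \<bullet> (- (h $ grp l)))) (at xh)"
    by (simp add: deviation_def)
  ultimately show ?thesis
    by (simp add: frechet_derivative_at[symmetric] inner_diff_right sum_negf sum_subtractf)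
qed

section \<open>Comparison functions and the interface\<close>

lemma class_K_inf_linear:
  assumes "k > 0"
  shows "class_K_inf (\<lambda>s. k * s)"
  unfolding class_K_inf_def class_K_def using assms
  by (auto intro!: continuous_intros strict_mono_onI filterlim_tendsto_pos_mult_at_top[OF tendsto_const]
      filterlim_ident)

lemma class_K_inf_square:
  assumes "k > 0"
  shows "class_K_inf (\<lambda>s. k * s\<^sup>2)"
  unfolding class_K_inf_def class_K_def using assms
  by (auto intro!: continuous_intros strict_mono_onI power_strict_mono
      filterlim_tendsto_pos_mult_at_top[OF tendsto_const] filterlim_pow_at_top filterlim_ident)

lemma class_K_cong:
  assumes "class_K f" "\<And>s. s \<ge> 0 \<Longrightarrow> g s = f s"
  shows "class_K g"
proof -
  have "continuous_on {0..} g \<longleftrightarrow> continuous_on {0..} f"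
    using assms(2) by (intro continuous_on_cong) auto
  then show ?thesis
    using assms by (auto simp: class_K_def strict_mono_on_def)
qed

lemma class_K_add:
  assumes "class_K f" "class_K g"
  shows "class_K (\<lambda>s. f s + g s)"
  using assms by (auto simp: class_K_def strict_mono_on_def intro!: continuous_intros add_strict_mono)

lemma class_K_or_zero_add:
  assumes "class_K_or_zero f" "class_K_or_zero g"
  shows "class_K_or_zero (\<lambda>s. f s + g s)"
proof -
  consider "class_K f" "class_K g" | "class_K f" "\<forall>s\<ge>0. g s = 0"
    | "\<forall>s\<ge>0. f s = 0" "class_K g" | "\<forall>s\<ge>0. f s = 0" "\<forall>s\<ge>0. g s = 0"
    using assms unfolding class_K_or_zero_def by blast
  then show ?thesis
  proof cases
    case 1
    then show ?thesis by (simp add: class_K_or_zero_def class_K_add)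
  next
    case 2
    then show ?thesis unfolding class_K_or_zero_def by (intro disjI1 class_K_cong[OF 2(1)]) simp
  next
    case 3
    then show ?thesis unfolding class_K_or_zero_def by (intro disjI1 class_K_cong[OF 3(2)]) simp
  next
    case 4
    then show ?thesis by (simp add: class_K_or_zero_def)
  qed
qed

lemma class_K_or_zero_sum:
  assumes "finite A" "\<And>l. l \<in> A \<Longrightarrow> class_K_or_zero (\<rho> l)"
  shows "class_K_or_zero (\<lambda>s. \<Sum>l\<in>A. \<rho> l s)"
  using assms
proof (induction A)
  case empty
  then show ?case by (simp add: class_K_or_zero_def)
next
  case (insert a A)
  then show ?case by (simp add: class_K_or_zero_add)
qed

lemma class_K_or_zero_mono:
  assumes "class_K_or_zero \<rho>" "0 \<le> s" "s \<le> t"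
  shows "\<rho> s \<le> \<rho> t"
proof (cases "s = t")
  case False
  with assms have "s \<in> {0..}" "t \<in> {0..}" "s < t" by auto
  with assms(1) show ?thesis
    unfolding class_K_or_zero_def class_K_def strict_mono_on_def by (auto intro: less_imp_le)
qed simp

lemma lipschitz_on_vec_lambda:
  fixes f :: "'l::finite \<Rightarrow> 'a::metric_space \<Rightarrow> 'b::real_normed_vector"
  assumes "\<And>l. (K l)-lipschitz_on S (f l)"
  shows "(\<Sum>l\<in>UNIV. K l)-lipschitz_on S (\<lambda>z. \<chi> l. f l z)"
proof (rule lipschitz_onI)
  fix y z assume yz: "y \<in> S" "z \<in> S"
  have "dist (\<chi> l. f l y) (\<chi> l. f l z) = L2_set (\<lambda>l. dist (f l y) (f l z)) UNIV"
    by (simp add: dist_vec_def)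
  also have "\<dots> \<le> (\<Sum>l\<in>UNIV. dist (f l y) (f l z))"
    by (rule L2_set_le_sum) simp
  also have "\<dots> \<le> (\<Sum>l\<in>UNIV. K l * dist y z)"
    by (intro sum_mono lipschitz_onD[OF assms] yz)
  finally show "dist (\<chi> l. f l y) (\<chi> l. f l z) \<le> (\<Sum>l\<in>UNIV. K l) * dist y z"
    by (simp add: sum_distrib_right)
qed (intro sum_nonneg lipschitz_on_nonneg[OF assms])

lemma locally_lipschitz_vec_lambda:
  fixes f :: "'l::finite \<Rightarrow> 'a::metric_space \<Rightarrow> 'b::real_normed_vector"
  assumes "\<And>l. locally_lipschitz (f l)"
  shows "locally_lipschitz (\<lambda>z. \<chi> l. f l z)"
  unfolding locally_lipschitz_def
proof
  fix z
  have "\<forall>l. \<exists>u K. u > 0 \<and> K-lipschitz_on (cball z u) (f l)"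
    using assms unfolding locally_lipschitz_def by blast
  then obtain u K where uK: "\<And>l. u l > 0" "\<And>l. (K l)-lipschitz_on (cball z (u l)) (f l)"
    by metis
  obtain r where r: "r > 0" "\<And>l. r \<le> u l"
    using finite_family_lower_bound[of u] uK(1) by blast
  have "(K l)-lipschitz_on (cball z r) (f l)" for l
    using uK(2) by (rule lipschitz_on_subset) (auto intro: order_trans[OF _ r(2)])
  then show "\<exists>r>0. \<exists>K. K-lipschitz_on (cball z r) (\<lambda>z. \<chi> l. f l z)"
    using r(1) lipschitz_on_vec_lambda by blast
qed

lemma locally_lipschitz_compose_nonexpansive:
  assumes f: "locally_lipschitz f" and p: "1-lipschitz_on UNIV p"
  shows "locally_lipschitz (\<lambda>z. f (p z))"
  unfolding locally_lipschitz_def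
proof
  fix z
  obtain u K where uK: "u > 0" "K-lipschitz_on (cball (p z) u) f"
    using f unfolding locally_lipschitz_def by blast
  have "p ` cball z u \<subseteq> cball (p z) u"
    using lipschitz_onD[OF p] by (fastforce intro: order_trans)
  then have "K-lipschitz_on (p ` cball z u) f"
    by (rule lipschitz_on_subset[OF uK(2)])
  moreover have "1-lipschitz_on (cball z u) p"
    using p by (rule lipschitz_on_subset) simp
  ultimately have "(K * 1)-lipschitz_on (cball z u) (\<lambda>z. f (p z))"
    by (intro lipschitz_on_compose2)
  then show "\<exists>u>0. \<exists>K. K-lipschitz_on (cball z u) (\<lambda>z. f (p z))"
    using uK(1) by blast
qed

text \<open>
  Agent \<open>l\<close> reads its own state and the aggregate state and input of its group. These coordinate
  projections are nonexpansive, so they preserve local Lipschitz continuity.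
\<close>

lemma locally_lipschitz_interface:
  fixes v :: "'l::finite \<Rightarrow> real^'n \<Rightarrow> real^'n \<Rightarrow> real^'m \<Rightarrow> real^'m" and grp :: "'l \<Rightarrow> 'g::finite"
  assumes "\<And>l. locally_lipschitz (\<lambda>(x, xh, uh). v l x xh uh)"
  shows "locally_lipschitz (\<lambda>(x :: real^'n^'l, xh, uh). \<chi> l. v l (x $ l) (xh $ grp l) (uh $ grp l))"
proof -
  define p where "p l z = (fst z $ l, fst (snd z) $ grp l, snd (snd z) $ grp l)"
    for l and z :: "(real^'n^'l) \<times> (real^'n^'g) \<times> (real^'m^'g)"
  have "1-lipschitz_on UNIV (p l)" for l
  proof (rule lipschitz_onI)
    show "dist (p l y) (p l z) \<le> 1 * dist y z" for y z
      by (simp add: p_def dist_prod_def)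
        (intro real_sqrt_le_mono add_mono power_mono dist_vec_nth_le; simp)
  qed simp
  then have "locally_lipschitz (\<lambda>z. \<chi> l. (\<lambda>(x, xh, uh). v l x xh uh) (p l z))"
    by (intro locally_lipschitz_vec_lambda locally_lipschitz_compose_nonexpansive[OF assms])
  then show ?thesis by (simp add: p_def case_prod_unfold)
qed

section \<open>The dissipation inequality\<close>

text \<open>
  Half of the decay rate \<open>-(\<lambda> + \<theta>)\<close> is kept; the other half pays, by Young's inequality, for the
  cross term between the deviation and \<open>Q (\<alpha> - \<alpha>nom)\<close> at the aggregate state. The identity
  \<open>Q B = C\<^sup>T\<close> turns the contribution of the internal inputs into a product with the output deviation.
\<close>

lemma agent_dissipation:
  fixes \<alpha> \<alpha>nom :: "real^'n \<Rightarrow> real^'n" and \<beta> \<beta>nom :: "real^'n \<Rightarrow> real^'m^'n"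
    and Q :: "real^'n^'n" and B :: "real^'p^'n" and C :: "real^'n^'p"
  assumes diff: "\<And>z. \<alpha> differentiable at z"
    and sym: "transpose Q = Q"
    and jac: "\<And>z. Q ** jacobian \<alpha> (at z) + transpose (jacobian \<alpha> (at z)) ** Q
                    \<preceq> (2 * lam) *\<^sub>R mat 1"
    and inp: "(x - xh) \<bullet> (Q *v (\<beta> x *v v - \<beta>nom xh *v uh)) \<le> theta * (norm (x - xh))\<^sup>2 + r"
    and neg: "lam + theta < 0"
    and QB: "Q ** B = transpose C"
  shows "(Q *v (x - xh)) \<bullet> (agent_dynamics \<alpha> \<beta> B x v w - agent_dynamics \<alpha>nom \<beta>nom B xh uh wh)
           \<le> (lam + theta) / 2 * (norm (x - xh))\<^sup>2 + r
             + (norm (Q *v (\<alpha> xh - \<alpha>nom xh)))\<^sup>2 / (- 2 * (lam + theta))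
             + (C *v (x - xh)) \<bullet> (w - wh)"
proof -
  define e where "e = x - xh"
  define \<delta> where "\<delta> = Q *v (\<alpha> xh - \<alpha>nom xh)"
  define c where "c = - (lam + theta)"
  have "c > 0" using neg by (simp add: c_def)
  have move: "(Q *v e) \<bullet> y = e \<bullet> (Q *v y)" for y
    by (simp add: inner_matrix_vector_symmetric[OF sym])
  have "agent_dynamics \<alpha> \<beta> B x v w - agent_dynamics \<alpha>nom \<beta>nom B xh uh wh
      = (\<alpha> x - \<alpha> xh) + (\<alpha> xh - \<alpha>nom xh) + (\<beta> x *v v - \<beta>nom xh *v uh) + B *v (w - wh)"
    by (simp add: agent_dynamics_def matrix_vector_mult_diff_distrib)
  then have split: "(Q *v e) \<bullet> (agent_dynamics \<alpha> \<beta> B x v w - agent_dynamics \<alpha>nom \<beta>nom B xh uh wh)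
      = e \<bullet> (Q *v (\<alpha> x - \<alpha> xh)) + e \<bullet> \<delta> + e \<bullet> (Q *v (\<beta> x *v v - \<beta>nom xh *v uh))
        + e \<bullet> (Q *v (B *v (w - wh)))"
    by (simp only: inner_add_right move \<delta>_def)
  have "e \<bullet> (Q *v (\<alpha> x - \<alpha> xh)) \<le> lam * (norm e)\<^sup>2"
    unfolding e_def by (rule contraction_from_jacobian_bound[OF diff sym jac])
  moreover have "e \<bullet> (Q *v (B *v (w - wh))) = (C *v e) \<bullet> (w - wh)"
    by (simp add: matrix_vector_mul_assoc QB inner_matrix_vector_transpose[of _ "transpose C"]
        del: transpose_matrix_vector)
  moreover have "e \<bullet> \<delta> \<le> c / 2 * (norm e)\<^sup>2 + (norm \<delta>)\<^sup>2 / (2 * c)"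
  proof -
    have "0 \<le> (norm (c *\<^sub>R e - \<delta>))\<^sup>2 / (2 * c)" using \<open>c > 0\<close> by simp
    also have "(norm (c *\<^sub>R e - \<delta>))\<^sup>2 = c\<^sup>2 * (norm e)\<^sup>2 - 2 * c * (e \<bullet> \<delta>) + (norm \<delta>)\<^sup>2"
      by (simp only: power2_norm_eq_inner)
        (simp add: inner_diff_left inner_diff_right inner_commute[of \<delta> e] power2_eq_square algebra_simps)
    also have "\<dots> / (2 * c) = c / 2 * (norm e)\<^sup>2 + (norm \<delta>)\<^sup>2 / (2 * c) - e \<bullet> \<delta>"
      using \<open>c > 0\<close> by (simp add: field_simps power2_eq_square)
    finally show ?thesis by simp
  qed
  moreover have "lam * (norm e)\<^sup>2 + c / 2 * (norm e)\<^sup>2 + theta * (norm e)\<^sup>2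
      = (lam + theta) / 2 * (norm e)\<^sup>2"
    by (simp add: c_def field_simps)
  moreover have "- 2 * (lam + theta) = 2 * c" by (simp add: c_def)
  ultimately show ?thesis
    using inp split unfolding e_def[symmetric] \<delta>_def[symmetric] by simp
qed

lemma practical_simulation_functionI:
  assumes "continuously_differentiable (\<lambda>(x, xh). V x xh)" "\<And>x xh. 0 \<le> V x xh"
    and "locally_lipschitz (\<lambda>(x, xh, uh). v x xh uh)"
    and "class_K_inf \<nu>" "class_K_inf \<eta>" "class_K_or_zero \<rho>" "\<And>xh. 0 \<le> \<Delta> xh"
    and "\<And>x xh. \<nu> (norm (h x - hh xh)) \<le> V x xh"
    and "\<And>x xh uh. frechet_derivative (\<lambda>z. V z xh) (at x) (f x (v x xh uh))
             + frechet_derivative (\<lambda>z. V x z) (at xh) (fh xh uh)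
             \<le> - \<eta> (V x xh) + \<rho> (norm uh) + \<Delta> xh"
  shows "practical_simulation_function f h fh hh V"
  unfolding practical_simulation_function_def
  by (rule conjI, rule assms, rule conjI, simp add: assms, rule exI[of _ v], rule exI[of _ \<nu>],
      rule exI[of _ \<eta>], rule exI[of _ \<rho>], rule exI[of _ \<Delta>])
    (intro conjI allI assms)

lemma norm_concrete_minus_aggregate_output:
  "(norm (concrete_output x - aggregate_output grp xh))\<^sup>2 = (\<Sum>l\<in>UNIV. (norm (x $ l - xh $ grp l))\<^sup>2)"
  by (simp add: concrete_output_def aggregate_output_def norm_vec_def L2_set_def sum_nonneg)

text \<open>
  Summation over the agents turns the remaining cross terms into the supply that the linear matrix
  inequality bounds. The interface couples an agent to the input of its group; monotonicity of
  \<open>\<rho>\<^sub>l\<close> replaces the norm of this block by the norm of the whole aggregate input.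
\<close>

lemma practical_simulation_function_of_relaxed_lmi:
  fixes \<alpha> :: "'l::finite \<Rightarrow> real^'n \<Rightarrow> real^'n" and \<beta> :: "'l \<Rightarrow> real^'n \<Rightarrow> real^'m^'n"
    and \<alpha>nom :: "real^'n \<Rightarrow> real^'n" and \<beta>nom :: "real^'n \<Rightarrow> real^'m^'n"
    and B :: "real^'p^'n" and C :: "real^'n^'p" and M :: "real^'l^'l" and Mbar :: "real^'g^'g"
    and grp :: "'l \<Rightarrow> 'g::finite" and Z :: "real^('g \<times> 'p)^('g \<times> 'p)"
  assumes diff: "\<And>l z. \<alpha> l differentiable at z"
    and vt: "\<And>l. locally_lipschitz (\<lambda>(x, xh, uh). vt l x xh uh)"
    and \<rho>t: "\<And>l. class_K_or_zero (\<rho>t l)"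
    and Q: "\<And>l. pos_def (Q l)"
    and jac: "\<And>l x. Q l ** jacobian (\<alpha> l) (at x) + transpose (jacobian (\<alpha> l) (at x)) ** Q l
                 \<preceq> (2 * lam l) *\<^sub>R mat 1"
    and inp: "\<And>l x xh uh.
           (x - xh) \<bullet> (Q l *v (\<beta> l x *v vt l x xh uh - \<beta>nom xh *v uh))
             \<le> theta l * (norm (x - xh))\<^sup>2 + \<rho>t l (norm uh)"
    and neg: "\<And>l. lam l + theta l < 0"
    and QB: "\<And>l. Q l ** B = transpose C"
    and Z: "pos_semidef Z"
    and lmi: "relaxed_lmi M (M ** partition_matrix grp - partition_matrix grp ** Mbar) Z"
  shows "practical_simulation_function
           (interconnected_dynamics (\<lambda>l. agent_dynamics (\<alpha> l) (\<beta> l) B) M C) concrete_output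
           (interconnected_dynamics (\<lambda>i. agent_dynamics \<alpha>nom \<beta>nom B) Mbar C) (aggregate_output grp)
           (composite_V (\<lambda>i. 1) Q grp)"
proof -
  let ?f = "interconnected_dynamics (\<lambda>l. agent_dynamics (\<alpha> l) (\<beta> l) B) M C"
  let ?fh = "interconnected_dynamics (\<lambda>i. agent_dynamics \<alpha>nom \<beta>nom B) Mbar C"
  let ?V = "composite_V (\<lambda>i. 1) Q grp"
  have sym: "transpose (Q l) = Q l" for l using Q by (simp add: pos_def_def)
  obtain k K where k: "k > 0" "\<And>l e. k * (norm e)\<^sup>2 \<le> e \<bullet> (Q l *v e)"
    and K: "K > 0" "\<And>l e. e \<bullet> (Q l *v e) \<le> K * (norm e)\<^sup>2"
    using uniform_quadratic_form_bounds[of Q, OF Q] by blast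
  have "0 < - (lam l + theta l)" for l using neg[of l] by simp
  then obtain c where c: "c > 0" "\<And>l. c \<le> - (lam l + theta l)"
    using finite_family_lower_bound[of "\<lambda>l. - (lam l + theta l)"] by blast
  define E where "E x xh = (\<Sum>l\<in>UNIV. (norm (x $ l - xh $ grp l))\<^sup>2)"
    for x :: "real^'n^'l" and xh :: "real^'n^'g"
  define v where "v x xh uh = (\<chi> l. vt l (x $ l) (xh $ grp l) (uh $ grp l))"
    for x :: "real^'n^'l" and xh :: "real^'n^'g" and uh :: "real^'m^'g"
  define \<rho> where "\<rho> s = (\<Sum>l\<in>UNIV. \<rho>t l s)" for s
  \<comment> \<open>The two parts of \<open>\<Delta>\<close>: the supply \<open>zeta\<^sup>T Z zeta\<close> due to the defect of equitability, and the
    price \<open>\<delta>\<close> of the heterogeneity of the agents.\<close>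
  define zeta where "zeta xh = stack (\<chi> i. C *v (xh $ i))" for xh :: "real^'n^'g"
  define \<delta> where "\<delta> xh = (\<Sum>l\<in>UNIV. (norm (Q l *v (\<alpha> l (xh $ grp l) - \<alpha>nom (xh $ grp l))))\<^sup>2
                                    / (- 2 * (lam l + theta l)))" for xh :: "real^'n^'g"
  have V_lower: "k / 2 * E x xh \<le> ?V x xh" for x xh
    unfolding composite_V_eq_sum agent_V_def E_def sum_distrib_left
    by (intro sum_mono) (use k(2) in simp)
  have V_upper: "?V x xh \<le> K / 2 * E x xh" for x xh
    unfolding composite_V_eq_sum agent_V_def E_def sum_distrib_left
    by (intro sum_mono) (use K(2) in simp)
  have V_nonneg: "0 \<le> ?V x xh" for x xh
  proof -
    have "0 \<le> k / 2 * E x xh" using k(1) by (simp add: E_def sum_nonneg)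
    also have "\<dots> \<le> ?V x xh" by (rule V_lower)
    finally show ?thesis .
  qed
  have dissipation: "frechet_derivative (\<lambda>z. ?V z xh) (at x) (?f x (v x xh uh))
        + frechet_derivative (\<lambda>z. ?V x z) (at xh) (?fh xh uh)
      \<le> - (c / K * ?V x xh) + \<rho> (norm uh) + (\<delta> xh + zeta xh \<bullet> (Z *v zeta xh))" for x xh uh
  proof -
    define w where "w = interconnection_input M C x"
    define wh where "wh = interconnection_input Mbar C xh"
    have "frechet_derivative (\<lambda>z. ?V z xh) (at x) (?f x (v x xh uh))
        + frechet_derivative (\<lambda>z. ?V x z) (at xh) (?fh xh uh)
      = (\<Sum>l\<in>UNIV. (Q l *v (x $ l - xh $ grp l)) \<bullet> (?f x (v x xh uh) $ l - ?fh xh uh $ grp l))"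
      by (rule composite_V_partial_derivatives[OF sym])
    also have "\<dots> \<le> (\<Sum>l\<in>UNIV. (- c / 2) * (norm (x $ l - xh $ grp l))\<^sup>2 + \<rho>t l (norm uh)
        + (norm (Q l *v (\<alpha> l (xh $ grp l) - \<alpha>nom (xh $ grp l))))\<^sup>2 / (- 2 * (lam l + theta l))
        + (C *v (x $ l - xh $ grp l)) \<bullet> (w $ l - wh $ grp l))"
    proof (rule sum_mono)
      fix l
      have "(Q l *v (x $ l - xh $ grp l)) \<bullet> (?f x (v x xh uh) $ l - ?fh xh uh $ grp l)
        \<le> (lam l + theta l) / 2 * (norm (x $ l - xh $ grp l))\<^sup>2 + \<rho>t l (norm (uh $ grp l))
          + (norm (Q l *v (\<alpha> l (xh $ grp l) - \<alpha>nom (xh $ grp l))))\<^sup>2 / (- 2 * (lam l + theta l))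
          + (C *v (x $ l - xh $ grp l)) \<bullet> (w $ l - wh $ grp l)"
        unfolding interconnected_dynamics_def v_def vec_lambda_beta w_def wh_def
        by (rule agent_dissipation[OF diff sym jac inp neg QB])
      moreover have "(lam l + theta l) / 2 * (norm (x $ l - xh $ grp l))\<^sup>2
          \<le> (- c / 2) * (norm (x $ l - xh $ grp l))\<^sup>2"
        using c(2)[of l] by (intro mult_right_mono) auto
      moreover have "\<rho>t l (norm (uh $ grp l)) \<le> \<rho>t l (norm uh)"
        by (rule class_K_or_zero_mono[OF \<rho>t]) (simp_all add: Finite_Cartesian_Product.norm_nth_le)
      ultimately show "(Q l *v (x $ l - xh $ grp l)) \<bullet> (?f x (v x xh uh) $ l - ?fh xh uh $ grp l)
        \<le> (- c / 2) * (norm (x $ l - xh $ grp l))\<^sup>2 + \<rho>t l (norm uh)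
          + (norm (Q l *v (\<alpha> l (xh $ grp l) - \<alpha>nom (xh $ grp l))))\<^sup>2 / (- 2 * (lam l + theta l))
          + (C *v (x $ l - xh $ grp l)) \<bullet> (w $ l - wh $ grp l)"
        by linarith
    qed
    also have "\<dots> = (- c / 2) * E x xh + \<rho> (norm uh) + \<delta> xh
        + (\<Sum>l\<in>UNIV. (C *v (x $ l - xh $ grp l)) \<bullet> (w $ l - wh $ grp l))"
      by (simp only: sum.distrib E_def \<rho>_def \<delta>_def sum_distrib_left)
    also have "(\<Sum>l\<in>UNIV. (C *v (x $ l - xh $ grp l)) \<bullet> (w $ l - wh $ grp l))
        \<le> zeta xh \<bullet> (Z *v zeta xh)"
      unfolding w_def wh_def zeta_def
      using Z lmi by (intro coupling_supply_bound) (simp_all add: pos_semidef_def)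
    also have "(- c / 2) * E x xh \<le> - (c / K * ?V x xh)"
    proof -
      have "c / K * ?V x xh \<le> c / K * (K / 2 * E x xh)"
        using c(1) K(1) by (intro mult_left_mono V_upper) simp
      then show ?thesis using K(1) by simp
    qed
    finally show ?thesis by simp
  qed
  show ?thesis
  proof (rule practical_simulation_functionI[where v = v and \<nu> = "\<lambda>s. k / 2 * s\<^sup>2"
        and \<eta> = "\<lambda>s. c / K * s" and \<rho> = \<rho>])
    show "continuously_differentiable (\<lambda>(x, xh). ?V x xh)"
      by (rule composite_V_continuously_differentiable[OF sym])
    show "0 \<le> ?V x xh" for x xh by (rule V_nonneg)
    show "locally_lipschitz (\<lambda>(x, xh, uh). v x xh uh)"
      unfolding v_def by (rule locally_lipschitz_interface[OF vt])
    show "class_K_inf (\<lambda>s. k / 2 * s\<^sup>2)" using k(1) by (intro class_K_inf_square) simp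
    show "class_K_inf (\<lambda>s. c / K * s)" using c(1) K(1) by (intro class_K_inf_linear) simp
    show "class_K_or_zero \<rho>" unfolding \<rho>_def by (rule class_K_or_zero_sum) (simp_all add: \<rho>t)
    show "0 \<le> \<delta> xh + zeta xh \<bullet> (Z *v zeta xh)" for xh
    proof -
      have "0 \<le> - 2 * (lam l + theta l)" for l using neg[of l] by simp
      then have "0 \<le> \<delta> xh" unfolding \<delta>_def by (intro sum_nonneg divide_nonneg_nonneg) simp_all
      moreover have "0 \<le> zeta xh \<bullet> (Z *v zeta xh)" using Z by (simp add: pos_semidef_def)
      ultimately show ?thesis by simp
    qed
    show "k / 2 * (norm (concrete_output x - aggregate_output grp xh))\<^sup>2 \<le> ?V x xh" for x xh
      unfolding norm_concrete_minus_aggregate_output using V_lower by (simp add: E_def)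
    show "frechet_derivative (\<lambda>z. ?V z xh) (at x) (?f x (v x xh uh))
        + frechet_derivative (\<lambda>z. ?V x z) (at xh) (?fh xh uh)
      \<le> - (c / K * ?V x xh) + \<rho> (norm uh) + (\<delta> xh + zeta xh \<bullet> (Z *v zeta xh))" for x xh uh
      by (rule dissipation)
  qed
qed

lemma continuously_differentiable_imp_differentiable:
  "continuously_differentiable f \<Longrightarrow> f differentiable at z"
  unfolding continuously_differentiable_def differentiable_def by blast

theorem theorem5:
  fixes \<alpha> :: "'l::{finite,linorder} \<Rightarrow> real^'n \<Rightarrow> real^'n"
    and \<beta> :: "'l \<Rightarrow> real^'n \<Rightarrow> real^'m^'n"
    and \<alpha>nom :: "real^'n \<Rightarrow> real^'n"
    and \<beta>nom :: "real^'n \<Rightarrow> real^'m^'n"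
    and B :: "real^'p^'n" and C :: "real^'n^'p"
    and Mt :: "((real, 'l) vec, 'l) vec"
    and vt :: "'l \<Rightarrow> real^'n \<Rightarrow> real^'n \<Rightarrow> real^'m \<Rightarrow> real^'m"
    and \<rho>t :: "'l \<Rightarrow> real \<Rightarrow> real"
    and lam theta :: "'l \<Rightarrow> real"
    and Q :: "'l \<Rightarrow> real^'n^'n"
    and grp :: "'l \<Rightarrow> 'g::{finite,linorder}"
    and P :: "((real, 'g) vec, 'l) vec"
    and Mbar :: "((real, 'g) vec, 'g) vec"
    and \<Sigma>dyn :: "(real^'n, 'l) vec \<Rightarrow> (real^'m, 'l) vec \<Rightarrow> (real^'n, 'l) vec"
    and \<Sigma>hatdyn :: "(real^'n, 'g) vec \<Rightarrow> (real^'m, 'g) vec \<Rightarrow> (real^'n, 'g) vec"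
    and V :: "(real^'n, 'l) vec \<Rightarrow> (real^'n, 'g) vec \<Rightarrow> real"
    and Ybar :: "((real, 'g) vec, 'l) vec"
  defines "P \<equiv> partition_matrix grp"
    and "\<Sigma>dyn \<equiv> interconnected_dynamics (\<lambda>l. agent_dynamics (\<alpha> l) (\<beta> l) B) Mt C"
    and "\<Sigma>hatdyn \<equiv> interconnected_dynamics (\<lambda>i. agent_dynamics \<alpha>nom \<beta>nom B) Mbar C"
    and "V \<equiv> composite_V (\<lambda>i. 1) Q grp"
    and "Ybar \<equiv> Mt ** P - P ** Mbar"
  assumes "\<And>l. continuously_differentiable (\<alpha> l)"
    and "\<And>l. locally_lipschitz (\<lambda>(x, u, w). agent_dynamics (\<alpha> l) (\<beta> l) B x u w)"
    and "locally_lipschitz (\<lambda>(x, u, w). agent_dynamics \<alpha>nom \<beta>nom B x u w)"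
    and "Mt + transpose Mt \<preceq> 0"
    and "\<And>l. locally_lipschitz (\<lambda>(x, xh, uh). vt l x xh uh)"
    and "\<And>l. class_K_or_zero (\<rho>t l)"
    and "\<And>l. pos_def (Q l)"
    and "\<And>l x. Q l ** jacobian (\<alpha> l) (at x) + transpose (jacobian (\<alpha> l) (at x)) ** Q l
                 \<preceq> (2 * lam l) *\<^sub>R mat 1"
    and "\<And>l x xh uh.
           (x - xh) \<bullet> (Q l *v (\<beta> l x *v vt l x xh uh - \<beta>nom xh *v uh))
             \<le> theta l * (norm (x - xh))\<^sup>2 + \<rho>t l (norm uh)"
    and "\<And>l. lam l + theta l < 0"
    and "\<And>l. Q l ** B = transpose C"
    and "agent_partition grp"
  shows "(Mt ** P = P ** Mbar \<longrightarrow>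
            practical_simulation_function \<Sigma>dyn concrete_output \<Sigma>hatdyn (aggregate_output grp) V)
       \<and> (Ybar \<noteq> 0 \<and> (\<exists>Z :: real^('g \<times> 'p)^('g \<times> 'p). pos_semidef Z \<and> relaxed_lmi Mt Ybar Z) \<longrightarrow>
            practical_simulation_function \<Sigma>dyn concrete_output \<Sigma>hatdyn (aggregate_output grp) V)
       \<and> ((\<exists>Z :: real^('g \<times> 'p)^('g \<times> 'p). pos_semidef Z \<and> relaxed_lmi Mt Ybar Z) \<longleftrightarrow>
            null_space (Mt + transpose Mt) \<subseteq> null_space (transpose Ybar))"
proof -
  define solvable where "solvable \<longleftrightarrow>
    (\<exists>Z :: real^('g \<times> 'p)^('g \<times> 'p). pos_semidef Z \<and> relaxed_lmi Mt Ybar Z)"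
  have iff: "solvable \<longleftrightarrow> null_space (Mt + transpose Mt) \<subseteq> null_space (transpose Ybar)"
    unfolding solvable_def by (rule relaxed_lmi_solvable_iff[OF assms(9)])
  have sim: "practical_simulation_function \<Sigma>dyn concrete_output \<Sigma>hatdyn (aggregate_output grp) V"
    if solvable
  proof -
    from that obtain Z :: "real^('g \<times> 'p)^('g \<times> 'p)"
      where Z: "pos_semidef Z" "relaxed_lmi Mt Ybar Z"
      unfolding solvable_def by blast
    show ?thesis
      unfolding \<Sigma>dyn_def \<Sigma>hatdyn_def V_def
      by (rule practical_simulation_function_of_relaxed_lmi
          [OF continuously_differentiable_imp_differentiable[OF assms(6)] assms(10-16) Z(1)
            Z(2)[unfolded Ybar_def P_def]])
  qed
  have "solvable" if "Mt ** P = P ** Mbar"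
  proof -
    have "transpose Ybar = 0" using that by (simp add: Ybar_def transpose_linear)
    then show ?thesis unfolding iff by (simp add: null_space_def)
  qed
  with sim iff show ?thesis unfolding solvable_def by blast
qed

end
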